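(* Let $A=(a,b,c,d,u_0,w_0)$ be real parameters with $ad-bc=1$ and $b\neq 0$. Let $\phi\in L^2(\mathbb{R})\setminus\{0\}$ be a window function, $f\in L^2(\mathbb{R})$ and $s\in\mathbb{R}$, and put $M_{s}f(t)=f(t)e^{ist}$. Then for all $u,w\in\mathbb{R}$, $$V^{A}_{\phi}\{M_{s}f\}(u,w)=V^{A}_{\phi}\{f\}(u-bs,\,w)\; e^{ibsw_0-i\frac{db}{2}s^2+ids(u-u_0)}.$$
   Context: All functions are complex-valued. For $A=(a,b,c,d,u_0,w_0)\in\mathbb{R}^6$ with $ad-bc=1$, $b\neq 0$, the offset linear canonical transform kernel is $$K_A(t,u)=\frac{1}{\sqrt{i2\pi b}}\exp\Big(i\frac{a}{2b}t^2-i\frac1b t(u-u_0)-i\frac1b u(du_0-bw_0)+i\frac{d}{2b}(u^2+u_0^2)\Big)$$ (principal square root). For $\phi\in L^2(\mathbb{R})\setminus\{0\}$ and $f\in L^2(\mathbb{R})$, the windowed offset linear canonical transform (WOLCT) is $$V^A_\phi \{f\}(u,w)=V^A_\phi f(u,w)=\int_{\mathbb{R}} f(t)\,\overline{\phi(t-w)}\,K_A(t,u)\,dt .$$ *)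

theory Defs
  imports "HOL-Analysis.Analysis"
begin

text \<open>
  Elements of \<open>L\<^sup>2(\<real>)\<close> are represented by complex-valued Lebesgue measurable functions;
  being nonzero in \<open>L\<^sup>2(\<real>)\<close> means not vanishing almost everywhere.
\<close>

definition L2_fun :: "(real \<Rightarrow> complex) \<Rightarrow> bool" where
  "L2_fun f \<longleftrightarrow> f \<in> borel_measurable lebesgue \<and> integrable lebesgue (\<lambda>t. (cmod (f t))\<^sup>2)"

definition L2_nonzero :: "(real \<Rightarrow> complex) \<Rightarrow> bool" where
  "L2_nonzero f \<longleftrightarrow> \<not> (AE t in lebesgue. f t = 0)"

type_synonym olct_params = "real \<times> real \<times> real \<times> real \<times> real \<times> real"

text \<open>Only meaningful for \<open>b \<noteq> 0\<close>; \<^const>\<open>csqrt\<close> is the principal square root.\<close>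

fun olct_kernel :: "olct_params \<Rightarrow> real \<Rightarrow> real \<Rightarrow> complex" where
  "olct_kernel (a, b, c, d, u0, w0) t u =
     1 / csqrt (\<i> * 2 * of_real pi * of_real b) *
     exp (\<i> * of_real (a / (2 * b) * t\<^sup>2)
          - \<i> * of_real (1 / b * t * (u - u0))
          - \<i> * of_real (1 / b * u * (d * u0 - b * w0))
          + \<i> * of_real (d / (2 * b) * (u\<^sup>2 + u0\<^sup>2)))"

definition wolct ::
    "olct_params \<Rightarrow> (real \<Rightarrow> complex) \<Rightarrow> (real \<Rightarrow> complex) \<Rightarrow> real \<Rightarrow> real \<Rightarrow> complex" where
  "wolct A \<phi> f u w = (LINT t|lebesgue. f t * cnj (\<phi> (t - w)) * olct_kernel A t u)"

definition modulation :: "real \<Rightarrow> (real \<Rightarrow> complex) \<Rightarrow> real \<Rightarrow> complex" where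
  "modulation s f t = f t * exp (\<i> * of_real (s * t))"

end

theory Submission
  imports Defs
begin

text \<open>In the kernel's phase, \<open>t\<close> meets \<open>u\<close> only in
  \<open>- t * (u - u0) / b\<close>, so adding \<open>s * t\<close> amounts to replacing
  \<open>u\<close> by \<open>u - b * s\<close> there. Making this shift in the remaining
  \<open>u\<close>-terms as well costs a phase free of \<open>t\<close>.
  \<open>olct_kernel_modulation\<close> records this pointwise; the \<open>t\<close>-free factor
  then leaves the integral.\<close>

lemma olct_kernel_modulation:
  assumes "b \<noteq> 0"
  shows "exp (\<i> * of_real (s * t)) * olct_kernel (a, b, c, d, u0, w0) t u =
    olct_kernel (a, b, c, d, u0, w0) t (u - b * s) *
    exp (\<i> * of_real (b * s * w0) - \<i> * of_real (d * b / 2 * s\<^sup>2)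
         + \<i> * of_real (d * s * (u - u0)))"
proof -
  \<comment> \<open>The correction has two sources: the term linear in \<open>u\<close> gives
    \<open>b * s * w0 - d * s * u0\<close>, and completing the shift in \<open>u\<^sup>2\<close>
    gives \<open>d * s * u - d * b / 2 * s\<^sup>2\<close>.\<close>
  have phase: "s * t + (a / (2 * b) * t\<^sup>2 - 1 / b * t * (u - u0)
        - 1 / b * u * (d * u0 - b * w0) + d / (2 * b) * (u\<^sup>2 + u0\<^sup>2)) =
      (a / (2 * b) * t\<^sup>2 - 1 / b * t * (u - b * s - u0)
        - 1 / b * (u - b * s) * (d * u0 - b * w0) + d / (2 * b) * ((u - b * s)\<^sup>2 + u0\<^sup>2))
      + (b * s * w0 - d * b / 2 * s\<^sup>2 + d * s * (u - u0))"
    using assms by (simp add: field_simps power2_eq_square)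
  have combine: "\<i> * of_real p - \<i> * of_real q + \<i> * of_real r = \<i> * of_real (p - q + r)"
    "\<i> * of_real p - \<i> * of_real q - \<i> * of_real r + \<i> * of_real v =
      \<i> * of_real (p - q - r + v)" for p q r v
    by (simp_all add: algebra_simps)
  \<comment> \<open>Here \<open>k\<close> stands for the prefactor \<open>1 / csqrt (...)\<close>,
    which depends only on \<open>b\<close> and so survives the shift of \<open>u\<close>; only real
    phases have to be compared.\<close>
  have exp_product: "exp (\<i> * of_real x) * (k * exp (\<i> * of_real y)) =
      k * exp (\<i> * of_real y') * exp (\<i> * of_real z)"
    if "x + y = y' + z" for x y y' z :: real and k :: complex
  proof -
    have "\<i> * of_real x + \<i> * of_real y = \<i> * of_real y' + \<i> * (of_real z :: complex)"
      using that by (metis distrib_left of_real_add)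
    then show ?thesis
      by (simp only: mult.assoc mult.left_commute[of _ k] flip: exp_add)
  qed
  show ?thesis
    unfolding olct_kernel.simps combine by (rule exp_product[OF phase])
qed

theorem mainTheorem3:
  fixes A :: olct_params
    and a b c d u0 w0 s :: real
    and \<phi> f :: "real \<Rightarrow> complex"
  assumes "A = (a, b, c, d, u0, w0)"
    and "a * d - b * c = 1"
    and "b \<noteq> 0"
    and "L2_fun \<phi>" and "L2_nonzero \<phi>"
    and "L2_fun f"
  shows "\<forall>u w. wolct A \<phi> (modulation s f) u w =
           wolct A \<phi> f (u - b * s) w *
           exp (\<i> * of_real (b * s * w0) - \<i> * of_real (d * b / 2 * s\<^sup>2)
                + \<i> * of_real (d * s * (u - u0)))"
proof (intro allI)
  fix u w
  let ?E = "exp (\<i> * of_real (b * s * w0) - \<i> * of_real (d * b / 2 * s\<^sup>2)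
                 + \<i> * of_real (d * s * (u - u0)))"
  have "modulation s f t * cnj (\<phi> (t - w)) * olct_kernel A t u =
      f t * cnj (\<phi> (t - w)) * olct_kernel A t (u - b * s) * ?E" for t
  proof -
    have "modulation s f t * cnj (\<phi> (t - w)) * olct_kernel A t u =
        f t * cnj (\<phi> (t - w)) * (exp (\<i> * of_real (s * t)) * olct_kernel A t u)"
      by (simp only: modulation_def ac_simps)
    then show ?thesis
      unfolding assms(1) olct_kernel_modulation[OF assms(3)] by (simp only: mult.assoc)
  qed
  then show "wolct A \<phi> (modulation s f) u w = wolct A \<phi> f (u - b * s) w * ?E"
    \<comment> \<open>\<open>?E\<close> is constant in \<open>t\<close>. Pulling it out raises no
      integrability goal, since a non-integrable integrand has integral 0 by convention.\<close>
    unfolding wolct_def by (simp only: integral_mult_left_zero)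
qed

end
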